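(* Let $W$ denote the Wiener index, $PL$ the path length and $E$ the number of edges of a rooted tree, and write $S(n)=S(\tau(n))$ for each of these statistics $S$, where $\tau(n)$ is the rooted tree with Matula number $n$. Then for every positive integer $n$, $$W(n)=\begin{cases}0, & \text{if } n=1;\\ W(t)+PL(t)+E(t)+1, & \text{if } n=p_t \text{ with } t\ge 1;\\ W(r)+W(s)+PL(r)E(s)+PL(s)E(r), & \text{if } n=rs \text{ with } r,s\ge 2.\end{cases}$$
   Context: For $m\ge 1$ let $p_m$ denote the $m$-th prime ($p_1=2,p_2=3,p_3=5,\dots$). Rooted trees are finite and considered up to isomorphism of rooted trees. The Matula number $\mu(T)$ of a rooted tree $T$ is defined recursively: $\mu(T)=1$ for the one-vertex tree; otherwise, if $T_1,\dots,T_d$ are the subtrees rooted at the vertices adjacent to the root of $T$, then $\mu(T)=p_{\mu(T_1)}p_{\mu(T_2)}\cdots p_{\mu(T_d)}$. The map $\mu$ is a bijection from rooted trees to positive integers, and $\tau(n)$ denotes the rooted tree with Matula number $n$. Equivalently: $\tau(1)$ is the one-vertex tree; $\tau(p_t)$ is obtained from $\tau(t)$ by adding a new vertex, which becomes the root, joined by an edge to the root of $\tau(t)$; and, for $r,s\ge 2$, $\tau(rs)$ is obtained from $\tau(r)$ and $\tau(s)$ by identifying their roots. For a statistic $S$ on rooted trees, $S(n)$ means $S(\tau(n))$. The Wiener index of a tree is the sum of the distances between all unordered pairs of vertices. The level of a vertex is its distance from the root. The path length of a rooted tree is the sum of the levels of all its vertices. *)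

theory Defs
  imports Main "HOL-Library.Infinite_Set" "HOL-Computational_Algebra.Primes"
begin

text \<open>
  Vertices are natural numbers: every finite rooted tree has an isomorphic copy with such vertices,
  and all notions below are invariant under isomorphism of rooted trees.
\<close>

record rgraph =
  verts :: "nat set"
  edges :: "nat set set"
  root :: nat

definition adj :: "rgraph \<Rightarrow> (nat \<times> nat) set" where
  "adj G = {(u, v). {u, v} \<in> edges G}"

definition is_cycle :: "rgraph \<Rightarrow> nat list \<Rightarrow> bool" where
  "is_cycle G vs \<longleftrightarrow>
     3 \<le> length vs \<and> distinct vs \<and>
     successively (\<lambda>u v. (u, v) \<in> adj G) vs \<and> (last vs, hd vs) \<in> adj G"

definition rooted_tree :: "rgraph \<Rightarrow> bool" where
  "rooted_tree G \<longleftrightarrow>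
     finite (verts G) \<and> root G \<in> verts G \<and>
     (\<forall>e \<in> edges G. e \<subseteq> verts G \<and> card e = 2) \<and>
     (\<forall>u \<in> verts G. \<forall>v \<in> verts G. (u, v) \<in> (adj G)\<^sup>*) \<and>
     (\<nexists>vs. is_cycle G vs)"

definition gdist :: "rgraph \<Rightarrow> nat \<Rightarrow> nat \<Rightarrow> nat" where
  "gdist G u v = (LEAST k. (u, v) \<in> adj G ^^ k)"

definition level :: "rgraph \<Rightarrow> nat \<Rightarrow> nat" where
  "level G v = gdist G (root G) v"

text \<open>The condition \<open>u < v\<close> selects each unordered pair of distinct vertices exactly once.\<close>

definition wiener :: "rgraph \<Rightarrow> nat" where
  "wiener G = (\<Sum>(u, v) \<in> {(u, v). u \<in> verts G \<and> v \<in> verts G \<and> u < v}. gdist G u v)"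

definition path_length :: "rgraph \<Rightarrow> nat" where
  "path_length G = (\<Sum>v \<in> verts G. level G v)"

definition num_edges :: "rgraph \<Rightarrow> nat" where
  "num_edges G = card (edges G)"

definition children :: "rgraph \<Rightarrow> nat set" where
  "children G = {c. (root G, c) \<in> adj G}"

text \<open>
  The subtree rooted at a child \<open>c\<close> of the root is the connected component of \<open>c\<close> that remains
  after the root has been removed.
\<close>

definition branch_verts :: "rgraph \<Rightarrow> nat \<Rightarrow> nat set" where
  "branch_verts G c =
     {v \<in> verts G - {root G}.
        (c, v) \<in> (adj G \<inter> (verts G - {root G}) \<times> (verts G - {root G}))\<^sup>*}"

definition branch :: "rgraph \<Rightarrow> nat \<Rightarrow> rgraph" where
  "branch G c =
     \<lparr>verts = branch_verts G c, edges = {e \<in> edges G. e \<subseteq> branch_verts G c}, root = c\<rparr>"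

text \<open>
  Primes are indexed from 1, so \<open>nth_prime 1 = 2\<close>, whereas \<^const>\<open>enumerate\<close> counts from 0;
  the value at 0 is irrelevant.
\<close>

definition nth_prime :: "nat \<Rightarrow> nat" where
  "nth_prime m = enumerate {p. prime p} (m - 1)"

text \<open>
  For the one-vertex tree the product is empty, which gives the value 1. The value 0 outside
  rooted trees is a convention that makes the function total.
\<close>

function matula :: "rgraph \<Rightarrow> nat" where
  "matula G =
     (if rooted_tree G then \<Prod>c \<in> children G. nth_prime (matula (branch G c)) else 0)"
  by auto
termination
proof (relation "measure (\<lambda>G. card (verts G))")
  fix G c
  assume "rooted_tree G"
  then have "finite (verts G)" "root G \<in> verts G"
    by (auto simp: rooted_tree_def)
  moreover have "verts (branch G c) \<subseteq> verts G - {root G}"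
    by (auto simp: branch_def branch_verts_def)
  ultimately show "(branch G c, G) \<in> measure (\<lambda>G. card (verts G))"
    by (auto intro!: psubset_card_mono)
qed simp

declare matula.simps [simp del]

text \<open>
  A rooted tree is determined by its Matula number up to isomorphism only, so \<open>\<tau>(n)\<close> is an
  arbitrary representative of the isomorphism class.
\<close>

definition tau :: "nat \<Rightarrow> rgraph" where
  "tau n = (SOME T. rooted_tree T \<and> matula T = n)"

end

theory Submission
  imports Defs
begin

text \<open>
  Removing the root of a rooted tree leaves one branch for each child of the root, and the three
  statistics of the tree are expressed through those of the branches (\<open>num_edges_branches\<close>,
  \<open>path_length_branches\<close>, \<open>wiener_branches\<close>). For the number of edges and the path length this is
  a sum over the children. The Wiener index also has to count the paths that join different
  branches; these run through the root, so their lengths are sums of two levels. With the missing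
  diagonal terms they make up the product of path length and number of edges, and therefore
  \<open>W - PL * E\<close> is a sum over the children as well.

  By unique factorization, the Matula number \<open>n\<close> of a tree determines the multiset of the Matula
  numbers of its branches (\<open>matulas_of_branches\<close>). Induction then shows that the statistics depend
  on \<open>n\<close> only (\<open>statistics_matula\<close>), whichever representative of the isomorphism class \<open>tau n\<close>
  is, and turns the sums over children into sums over the prime factors of \<open>n\<close>
  (\<open>statistics_tau\<close>). For this \<open>tau n\<close> has to be a tree with Matula number \<open>n\<close>, and such a tree
  is built by grafting one tree for each prime factor onto a common root (\<open>matula_surj_above\<close>).

  The three cases of the recurrence are the cases of no prime factor, of one prime factor \<open>p\<^sub>t\<close>, and
  of a product \<open>r * s\<close>, whose multiset of prime factors is the sum of those of \<open>r\<close> and \<open>s\<close>: there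
  \<open>E\<close>, \<open>PL\<close> and \<open>W - PL * E\<close> are additive, and the mixed products that remain from
  \<open>(PL r + PL s) * (E r + E s)\<close> are the cross terms of the formula.
\<close>

section \<open>Distances in a graph\<close>

lemma sym_adj: "sym (adj G)"
  by (auto simp: sym_def adj_def insert_commute)

lemma adj_commute: "(u, v) \<in> adj G \<longleftrightarrow> (v, u) \<in> adj G"
  by (auto simp: adj_def insert_commute)

lemma gdist_walk: "(u, v) \<in> (adj G)\<^sup>* \<Longrightarrow> (u, v) \<in> adj G ^^ gdist G u v"
  unfolding gdist_def by (rule LeastI_ex) (rule rtrancl_imp_relpow)

lemma gdist_le: "(u, v) \<in> adj G ^^ k \<Longrightarrow> gdist G u v \<le> k"
  unfolding gdist_def by (rule Least_le)

lemma gdist_self [simp]: "gdist G u u = 0"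
  using gdist_le[where G = G and u = u and v = u and k = 0] by simp

lemma gdist_adj_le: "(u, v) \<in> adj G \<Longrightarrow> gdist G u v \<le> 1"
  by (rule gdist_le) simp

lemma gdist_triangle:
  assumes "(u, v) \<in> (adj G)\<^sup>*" and "(v, w) \<in> (adj G)\<^sup>*"
  shows "gdist G u w \<le> gdist G u v + gdist G v w"
  by (rule gdist_le) (use gdist_walk assms in \<open>auto simp: relpow_add\<close>)

lemma relpow_adj_commute: "(u, v) \<in> adj G ^^ k \<longleftrightarrow> (v, u) \<in> adj G ^^ k"
proof -
  have "(v, u) \<in> adj G ^^ k" if "(u, v) \<in> adj G ^^ k" for u v
    using that
  proof (induction k arbitrary: v)
    case (Suc k)
    then obtain w where "(u, w) \<in> adj G ^^ k" "(w, v) \<in> adj G"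
      by auto
    with Suc.IH show ?case
      by (meson adj_commute relpow_Suc_I2)
  qed simp
  then show ?thesis by blast
qed

lemma gdist_commute: "gdist G u v = gdist G v u"
  unfolding gdist_def using relpow_adj_commute by metis

text \<open>
  Every lower bound on a distance below comes from a potential \<open>h\<close> that grows by at most 1 along
  each edge: the length of a walk is at least the increase of \<open>h\<close> from its start to its end.
\<close>

lemma gdist_ge_potential:
  fixes h :: "nat \<Rightarrow> int"
  assumes "(u, v) \<in> (adj G)\<^sup>*"
    and step: "\<And>x y. (x, y) \<in> adj G \<Longrightarrow> h y \<le> h x + 1"
  shows "h v \<le> h u + int (gdist G u v)"
proof -
  have "h v \<le> h u + int k" if "(u, v) \<in> adj G ^^ k" for k v
    using that
  proof (induction k arbitrary: v)
    case (Suc k)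
    then obtain w where "(u, w) \<in> adj G ^^ k" "(w, v) \<in> adj G"
      by auto
    with Suc.IH[of w] step[of w v] show ?case by simp
  qed simp
  with gdist_walk[OF assms(1)] show ?thesis by blast
qed

lemma relpow_subset:
  fixes R S :: "('a \<times> 'a) set"
  shows "R \<subseteq> S \<Longrightarrow> (u, v) \<in> R ^^ k \<Longrightarrow> (u, v) \<in> S ^^ k"
  by (induction k arbitrary: v) auto

lemma double_wiener:
  assumes "finite (verts G)"
  shows "2 * wiener G = (\<Sum>u\<in>verts G. \<Sum>v\<in>verts G. gdist G u v)"
proof -
  let ?V = "verts G"
  let ?d = "\<lambda>(u, v). gdist G u v"
  let ?L = "{(u, v). u \<in> ?V \<and> v \<in> ?V \<and> u < v}"
  let ?R = "{(u, v). u \<in> ?V \<and> v \<in> ?V \<and> v < u}"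
  let ?D = "{(u, v). u \<in> ?V \<and> v \<in> ?V \<and> u = v}"
  have fin: "finite ?L" "finite ?R" "finite ?D"
    by (rule finite_subset[of _ "?V \<times> ?V"]; use assms in auto)+
  have "?V \<times> ?V = ?L \<union> ?R \<union> ?D" by auto
  then have "sum ?d (?V \<times> ?V) = sum ?d (?L \<union> ?R) + sum ?d ?D"
    using fin by (simp, intro sum.union_disjoint) auto
  also have "sum ?d (?L \<union> ?R) = sum ?d ?L + sum ?d ?R"
    using fin by (intro sum.union_disjoint) auto
  also have "sum ?d ?R = sum ?d ?L"
    by (rule sum.reindex_bij_witness[of _ prod.swap prod.swap]) (auto simp: gdist_commute)
  also have "sum ?d ?D = 0" by (auto intro!: sum.neutral)
  finally show ?thesis
    by (simp add: wiener_def sum.cartesian_product)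
qed

section \<open>Decomposition of a rooted tree at its root\<close>

lemma rooted_treeD:
  assumes "rooted_tree G"
  shows "finite (verts G)" "root G \<in> verts G"
    "\<And>e. e \<in> edges G \<Longrightarrow> e \<subseteq> verts G" "\<And>e. e \<in> edges G \<Longrightarrow> card e = 2"
    "\<And>u v. u \<in> verts G \<Longrightarrow> v \<in> verts G \<Longrightarrow> (u, v) \<in> (adj G)\<^sup>*"
    "\<And>vs. \<not> is_cycle G vs"
  using assms unfolding rooted_tree_def by blast+

lemma tree_adjD:
  assumes "rooted_tree G" and "(u, v) \<in> adj G"
  shows "u \<in> verts G" "v \<in> verts G" "u \<noteq> v"
proof -
  have e: "{u, v} \<in> edges G" using assms by (simp add: adj_def)
  show "u \<in> verts G" "v \<in> verts G" using rooted_treeD(3)[OF assms(1) e] by auto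
  show "u \<noteq> v" using rooted_treeD(4)[OF assms(1) e] by auto
qed

lemma rtrancl_simple_path:
  assumes "(x, y) \<in> R\<^sup>*"
  obtains vs where "vs \<noteq> []" "hd vs = x" "last vs = y" "distinct vs"
    "successively (\<lambda>u v. (u, v) \<in> R) vs"
proof -
  have "\<exists>vs. vs \<noteq> [] \<and> hd vs = x \<and> last vs = y \<and> distinct vs
          \<and> successively (\<lambda>u v. (u, v) \<in> R) vs"
    using assms
  proof (induction rule: rtrancl_induct)
    case base
    show ?case by (rule exI[of _ "[x]"]) simp
  next
    case (step y z)
    then obtain vs where vs: "vs \<noteq> []" "hd vs = x" "last vs = y" "distinct vs"
      "successively (\<lambda>u v. (u, v) \<in> R) vs" by blast
    show ?case
    proof (cases "z \<in> set vs")
      case True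
      \<comment> \<open>The walk revisits \<open>z\<close>, so it is cut off at the first visit.\<close>
      then obtain as bs where "vs = as @ z # bs" by (meson split_list)
      then have "vs = (as @ [z]) @ bs" by simp
      with vs show ?thesis
        by (intro exI[of _ "as @ [z]"])
           (auto simp: successively_append_iff hd_append split: if_splits)
    next
      case False
      with vs step.hyps show ?thesis
        by (intro exI[of _ "vs @ [z]"]) (auto simp: successively_append_iff)
    qed
  qed
  with that show ?thesis by blast
qed

lemma branch_simps [simp]:
  "verts (branch G c) = branch_verts G c" "root (branch G c) = c"
  "edges (branch G c) = {e \<in> edges G. e \<subseteq> branch_verts G c}"
  by (simp_all add: branch_def)

lemma adj_branch: "adj (branch G c) = adj G \<inter> branch_verts G c \<times> branch_verts G c"
  by (auto simp: adj_def)

lemma branch_verts_subset: "branch_verts G c \<subseteq> verts G - {root G}"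
  by (auto simp: branch_verts_def)

lemma root_notin_branch: "root G \<notin> branch_verts G c"
  by (auto simp: branch_verts_def)

lemma finite_branch_verts: "rooted_tree G \<Longrightarrow> finite (branch_verts G c)"
  using finite_subset[OF branch_verts_subset] rooted_treeD(1) by blast

lemma childD:
  assumes "rooted_tree G" and "c \<in> children G"
  shows "(root G, c) \<in> adj G" "c \<in> verts G" "c \<noteq> root G" "c \<in> branch_verts G c"
proof -
  show *: "(root G, c) \<in> adj G" using assms(2) by (simp add: children_def)
  show "c \<in> verts G" "c \<noteq> root G" using tree_adjD[OF assms(1) *] by auto
  then show "c \<in> branch_verts G c" by (simp add: branch_verts_def)
qed

lemma finite_children: "rooted_tree G \<Longrightarrow> finite (children G)"
  by (rule finite_subset[of _ "verts G"]) (auto dest: childD rooted_treeD)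

lemma branch_verts_closed:
  assumes "rooted_tree G" and "x \<in> branch_verts G c" and "(x, y) \<in> adj G" and "y \<noteq> root G"
  shows "y \<in> branch_verts G c"
  using assms tree_adjD[OF assms(1,3)]
  by (auto simp: branch_verts_def intro: rtrancl_into_rtrancl)

lemma branch_verts_cover:
  assumes "rooted_tree G" and "v \<in> verts G" and "v \<noteq> root G"
  obtains c where "c \<in> children G" "v \<in> branch_verts G c"
proof -
  have "(root G, v) \<in> (adj G)\<^sup>*" using rooted_treeD(2,5)[OF assms(1)] assms(2) by blast
  then have "v = root G \<or> (\<exists>c\<in>children G. v \<in> branch_verts G c)"
  proof (induction rule: rtrancl_induct)
    case (step y z)
    show ?case
    proof (cases "y = root G")
      case True
      then have "z \<in> children G" using step.hyps by (simp add: children_def)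
      then show ?thesis using childD(4)[OF assms(1)] by blast
    next
      case False
      then show ?thesis using step branch_verts_closed[OF assms(1)] by blast
    qed
  qed simp
  with assms(3) that show ?thesis by blast
qed

text \<open>
  Two children in one component of the tree without its root would be joined by a simple path
  avoiding the root; together with the root this path would be a cycle.
\<close>

lemma branch_verts_disjoint:
  assumes G: "rooted_tree G" and c: "c \<in> children G" and d: "d \<in> children G"
    and x: "x \<in> branch_verts G c" "x \<in> branch_verts G d"
  shows "c = d"
proof (rule ccontr)
  assume "c \<noteq> d"
  define R where "R = adj G \<inter> (verts G - {root G}) \<times> (verts G - {root G})"
  have "sym R" using sym_adj[of G] by (auto simp: R_def sym_def)
  moreover have "(c, x) \<in> R\<^sup>*" "(d, x) \<in> R\<^sup>*" using x by (auto simp: branch_verts_def R_def)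
  ultimately have "(c, d) \<in> R\<^sup>*" by (meson rtrancl_trans sym_rtrancl symD)
  then obtain vs where vs: "vs \<noteq> []" "hd vs = c" "last vs = d" "distinct vs"
    "successively (\<lambda>u v. (u, v) \<in> R) vs" by (rule rtrancl_simple_path)
  have "root G \<notin> set vs"
  proof
    assume "root G \<in> set vs"
    then obtain as bs where split: "vs = as @ root G # bs" by (meson split_list)
    have "as \<noteq> []" using split vs(2) childD(3)[OF G c] by auto
    then have "(last as, root G) \<in> R" using split vs(5) by (simp add: successively_append_iff)
    then show False by (simp add: R_def)
  qed
  moreover have "successively (\<lambda>u v. (u, v) \<in> adj G) vs"
    by (rule successively_mono[OF vs(5)]) (auto simp: R_def)
  moreover have "2 \<le> length vs"
    using vs(1-3) \<open>c \<noteq> d\<close> by (cases vs; cases "tl vs") auto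
  ultimately have "is_cycle G (root G # vs)"
    using vs childD(1)[OF G c] childD(1)[OF G d] adj_commute[of d "root G" G]
    by (auto simp: is_cycle_def successively_Cons)
  with rooted_treeD(6)[OF G] show False by blast
qed

lemma child_in_branch:
  assumes "rooted_tree G" and "c \<in> children G" and "d \<in> children G" and "d \<in> branch_verts G c"
  shows "d = c"
  using branch_verts_disjoint[OF assms(1,3,2) childD(4)[OF assms(1,3)] assms(4)] .

lemma branch_exit:
  assumes G: "rooted_tree G" and c: "c \<in> children G"
    and "x \<in> branch_verts G c" and "(x, y) \<in> adj G" and "y \<notin> branch_verts G c"
  shows "x = c" "y = root G"
proof -
  show y: "y = root G" using branch_verts_closed[OF G] assms by blast
  then have "x \<in> children G" using assms(4) adj_commute[of x y] by (simp add: children_def)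
  then show "x = c" using child_in_branch[OF G c] assms(3) by blast
qed

lemma branch_reach:
  assumes G: "rooted_tree G" and c: "c \<in> children G" and v: "v \<in> branch_verts G c"
  shows "(c, v) \<in> (adj (branch G c))\<^sup>*"
proof -
  define R where "R = adj G \<inter> (verts G - {root G}) \<times> (verts G - {root G})"
  have "(c, v) \<in> R\<^sup>*" using v by (simp add: branch_verts_def R_def)
  then have "v \<in> branch_verts G c \<and> (c, v) \<in> (adj (branch G c))\<^sup>*"
  proof (induction rule: rtrancl_induct)
    case base
    then show ?case using childD(4)[OF G c] by simp
  next
    case (step y z)
    then have "z \<in> branch_verts G c"
      using branch_verts_closed[OF G, of y c z] by (auto simp: R_def)
    moreover have "(y, z) \<in> adj (branch G c)"
      using step calculation by (auto simp: R_def adj_branch)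
    ultimately show ?case using step.IH by (meson rtrancl_into_rtrancl)
  qed
  then show ?thesis by simp
qed

lemma rooted_tree_branch:
  assumes G: "rooted_tree G" and c: "c \<in> children G"
  shows "rooted_tree (branch G c)"
  unfolding rooted_tree_def
proof (intro conjI)
  show "finite (verts (branch G c))" using finite_branch_verts[OF G] by simp
  show "root (branch G c) \<in> verts (branch G c)" using childD(4)[OF G c] by simp
  show "\<forall>e\<in>edges (branch G c). e \<subseteq> verts (branch G c) \<and> card e = 2"
    using rooted_treeD(4)[OF G] by auto
  show "\<forall>u\<in>verts (branch G c). \<forall>v\<in>verts (branch G c). (u, v) \<in> (adj (branch G c))\<^sup>*"
    using branch_reach[OF G c] sym_rtrancl[OF sym_adj[of "branch G c"]]
    by (auto dest: symD intro: rtrancl_trans)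
  have "is_cycle G vs" if "is_cycle (branch G c) vs" for vs
    using that unfolding is_cycle_def
    by (auto simp: adj_branch elim!: successively_mono)
  with rooted_treeD(6)[OF G] show "\<nexists>vs. is_cycle (branch G c) vs" by blast
qed

lemma card_branch_less:
  assumes "rooted_tree G"
  shows "card (verts (branch G c)) < card (verts G)"
  using rooted_treeD(1,2)[OF assms] branch_verts_subset[of G c]
  by (auto intro!: psubset_card_mono)

lemma rooted_tree_induct [consumes 1, case_names branches]:
  assumes "rooted_tree G"
    and "\<And>G. rooted_tree G \<Longrightarrow> (\<And>c. c \<in> children G \<Longrightarrow> P (branch G c)) \<Longrightarrow> P G"
  shows "P G"
  using assms(1)
proof (induction "card (verts G)" arbitrary: G rule: less_induct)
  case less
  show ?case
    by (rule assms(2)[OF less.prems])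
       (use less card_branch_less rooted_tree_branch in blast)
qed

lemma sum_verts_branches:
  fixes f :: "nat \<Rightarrow> nat"
  assumes G: "rooted_tree G"
  shows "sum f (verts G) = f (root G) + (\<Sum>c\<in>children G. sum f (branch_verts G c))"
proof -
  let ?U = "\<Union>c\<in>children G. branch_verts G c"
  have fin: "finite (children G)" "\<And>c. finite (branch_verts G c)"
    using finite_children[OF G] finite_branch_verts[OF G] .
  have "verts G \<subseteq> insert (root G) ?U"
    by (auto elim: branch_verts_cover[OF G])
  moreover have "insert (root G) ?U \<subseteq> verts G"
    using branch_verts_subset[of G] rooted_treeD(2)[OF G] by blast
  ultimately have "sum f (verts G) = sum f (insert (root G) ?U)"
    by (intro arg_cong[where f = "sum f"] equalityI)
  also have "\<dots> = f (root G) + sum f ?U"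
    by (rule sum.insert) (simp_all add: fin root_notin_branch)
  also have "sum f ?U = (\<Sum>c\<in>children G. sum f (branch_verts G c))"
  proof (rule sum.UNION_disjoint)
    show "\<forall>c\<in>children G. \<forall>d\<in>children G. c \<noteq> d \<longrightarrow> branch_verts G c \<inter> branch_verts G d = {}"
      using branch_verts_disjoint[OF G] by (meson disjoint_iff)
  qed (simp_all add: fin)
  finally show ?thesis .
qed

section \<open>Distances in terms of the branches\<close>

text \<open>
  A walk in the tree between two vertices of a branch is no shorter than a walk inside the branch:
  the retraction that sends everything outside the branch to its root \<open>c\<close> maps every edge to an
  edge of the branch or to a single vertex.
\<close>

lemma gdist_branch:
  assumes G: "rooted_tree G" and c: "c \<in> children G"
    and u: "u \<in> branch_verts G c" and v: "v \<in> branch_verts G c"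
  shows "gdist G u v = gdist (branch G c) u v"
proof (rule antisym)
  let ?B = "branch G c"
  have B: "rooted_tree ?B" by (rule rooted_tree_branch[OF G c])
  note reach = rooted_treeD(5)[OF B, simplified]
  have "adj ?B \<subseteq> adj G" by (auto simp: adj_branch)
  then have "(u, v) \<in> adj G ^^ gdist ?B u v"
    using relpow_subset[OF _ gdist_walk[OF reach[OF u v]]] by blast
  then show "gdist G u v \<le> gdist ?B u v" by (rule gdist_le)
  define retr where "retr x = (if x \<in> branch_verts G c then x else c)" for x
  have retr: "retr x \<in> branch_verts G c" for x using childD(4)[OF G c] by (simp add: retr_def)
  have edge: "retr x = retr y \<or> (retr x, retr y) \<in> adj ?B" if "(x, y) \<in> adj G" for x y
    using that branch_exit[OF G c, of x y] branch_exit[OF G c, of y x] adj_commute[of x y G]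
    by (auto simp: retr_def adj_branch)
  have "int (gdist ?B u (retr v)) \<le> int (gdist ?B u (retr u)) + int (gdist G u v)"
  proof (rule gdist_ge_potential)
    show "(u, v) \<in> (adj G)\<^sup>*"
      using rooted_treeD(5)[OF G] u v branch_verts_subset by blast
    fix x y assume "(x, y) \<in> adj G"
    with edge[OF this] gdist_triangle[OF reach reach, of u "retr x" "retr y"] u retr
      gdist_adj_le[of "retr x" "retr y" ?B]
    show "int (gdist ?B u (retr y)) \<le> int (gdist ?B u (retr x)) + 1"
      by auto
  qed
  then show "gdist ?B u v \<le> gdist G u v" using u v by (simp add: retr_def)
qed

lemma level_root [simp]: "level G (root G) = 0"
  by (simp add: level_def)

lemma level_adj_le:
  assumes "rooted_tree G" and "(x, y) \<in> adj G"
  shows "level G y \<le> level G x + 1"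
  using gdist_triangle[of "root G" x G y] gdist_adj_le[OF assms(2)]
    rooted_treeD(2,5)[OF assms(1)] tree_adjD[OF assms] assms(2)
  by (force simp: level_def)

lemma level_branch:
  assumes G: "rooted_tree G" and c: "c \<in> children G" and v: "v \<in> branch_verts G c"
  shows "level G v = level (branch G c) v + 1"
proof (rule antisym)
  have V: "v \<in> verts G" "c \<in> verts G" using v childD[OF G c] branch_verts_subset by auto
  note reach = rooted_treeD(5)[OF G]
  have "gdist G (root G) v \<le> gdist G (root G) c + gdist G c v"
    using reach V rooted_treeD(2)[OF G] by (intro gdist_triangle)
  then show "level G v \<le> level (branch G c) v + 1"
    using gdist_adj_le[OF childD(1)[OF G c]] gdist_branch[OF G c childD(4)[OF G c] v]
    by (simp add: level_def)
  define h where
    "h x = (if x \<in> branch_verts G c then int (level (branch G c) x) + 1 else 0)" for x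
  have "h v \<le> h (root G) + int (gdist G (root G) v)"
  proof (rule gdist_ge_potential)
    show "(root G, v) \<in> (adj G)\<^sup>*" using reach V rooted_treeD(2)[OF G] by blast
    fix x y assume xy: "(x, y) \<in> adj G"
    consider "x \<in> branch_verts G c" "y \<in> branch_verts G c"
      | "x \<notin> branch_verts G c" "y \<in> branch_verts G c" | "y \<notin> branch_verts G c"
      by blast
    then show "h y \<le> h x + 1"
    proof cases
      case 1
      then have "level (branch G c) y \<le> level (branch G c) x + 1"
        using xy by (intro level_adj_le rooted_tree_branch[OF G c]) (auto simp: adj_branch)
      with 1 show ?thesis by (simp add: h_def)
    next
      case 2
      then have "y = c" using branch_exit(1)[OF G c, of y x] xy adj_commute[of x y G] by blast
      with 2 show ?thesis using level_root[of "branch G c"] by (simp add: h_def)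
    qed (simp add: h_def)
  qed
  then show "level (branch G c) v + 1 \<le> level G v"
    using v root_notin_branch[of G c] by (simp add: h_def level_def)
qed

text \<open>
  A path between different branches passes through the root. For the lower bound the potential is
  the level with its sign reversed on the branch of \<open>u\<close>; the only edge leaving that branch joins
  its root to the root of the tree, where the potential goes from \<open>-1\<close> to \<open>0\<close>.
\<close>

lemma gdist_across_branches:
  assumes G: "rooted_tree G" and c: "c \<in> children G" and d: "d \<in> children G" and "c \<noteq> d"
    and u: "u \<in> branch_verts G c" and v: "v \<in> branch_verts G d"
  shows "gdist G u v = level G u + level G v"
proof (rule antisym)
  have V: "u \<in> verts G" "v \<in> verts G" "root G \<in> verts G"
    using u v branch_verts_subset rooted_treeD(2)[OF G] by auto
  note reach = rooted_treeD(5)[OF G]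
  show "gdist G u v \<le> level G u + level G v"
    using gdist_triangle[OF reach reach, of u "root G" v] V gdist_commute[of G u "root G"]
    by (simp add: level_def)
  define h where
    "h x = (if x \<in> branch_verts G c then - int (level G x) else int (level G x))" for x
  have "h v \<le> h u + int (gdist G u v)"
  proof (rule gdist_ge_potential)
    show "(u, v) \<in> (adj G)\<^sup>*" using reach V by blast
    fix x y assume xy: "(x, y) \<in> adj G"
    have lev: "level G y \<le> level G x + 1" "level G x \<le> level G y + 1"
      using level_adj_le[OF G] xy adj_commute[of x y G] by blast+
    consider "x \<in> branch_verts G c" "y \<in> branch_verts G c"
      | "x \<notin> branch_verts G c" "y \<in> branch_verts G c"
      | "x \<in> branch_verts G c" "y \<notin> branch_verts G c"
      | "x \<notin> branch_verts G c" "y \<notin> branch_verts G c"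
      by blast
    then show "h y \<le> h x + 1"
    proof cases
      case 3
      then have "y = root G" using branch_exit(2)[OF G c, of x y] xy by blast
      with 3 lev show ?thesis by (simp add: h_def)
    qed (use lev in \<open>simp_all add: h_def\<close>)
  qed
  moreover have "v \<notin> branch_verts G c"
    using branch_verts_disjoint[OF G c d _ v] \<open>c \<noteq> d\<close> by blast
  ultimately show "level G u + level G v \<le> gdist G u v"
    using u by (simp add: h_def)
qed

section \<open>The statistics in terms of the branches\<close>

lemma num_edges_branches:
  assumes G: "rooted_tree G"
  shows "num_edges G = (\<Sum>c\<in>children G. num_edges (branch G c) + 1)"
proof -
  let ?E = "\<lambda>c. insert {root G, c} (edges (branch G c))"
  have "edges G \<subseteq> Pow (verts G)" using rooted_treeD(3)[OF G] by blast
  then have fin: "finite (edges G)" using rooted_treeD(1)[OF G] finite_subset by blast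
  have "edges G = (\<Union>c\<in>children G. ?E c)"
  proof (intro equalityI subsetI)
    fix e assume e: "e \<in> edges G"
    with rooted_treeD(4)[OF G] obtain x y where xy: "e = {x, y}" by (meson card_2_iff)
    then have adj: "(x, y) \<in> adj G" "(y, x) \<in> adj G" using e adj_commute by (auto simp: adj_def)
    consider "x = root G" | "y = root G" | "x \<noteq> root G" "y \<noteq> root G" by blast
    then show "e \<in> (\<Union>c\<in>children G. ?E c)"
    proof cases
      case 3
      with branch_verts_cover[OF G] tree_adjD[OF G adj(1)] obtain c
        where c: "c \<in> children G" "x \<in> branch_verts G c" by blast
      with branch_verts_closed[OF G _ adj(1)] 3 have "y \<in> branch_verts G c" by blast
      with c e xy show ?thesis by auto
    qed (use adj xy in \<open>auto simp: children_def\<close>)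
  next
    fix e assume "e \<in> (\<Union>c\<in>children G. ?E c)"
    then show "e \<in> edges G" by (auto simp: children_def adj_def)
  qed
  also have "card (\<Union>c\<in>children G. ?E c) = (\<Sum>c\<in>children G. card (?E c))"
  proof (rule card_UN_disjoint)
    show "finite (children G)" by (rule finite_children[OF G])
    show "\<forall>c\<in>children G. finite (?E c)" using fin by simp
    show "\<forall>c\<in>children G. \<forall>d\<in>children G. c \<noteq> d \<longrightarrow> ?E c \<inter> ?E d = {}"
    proof (intro ballI impI equals0I)
      fix c d e
      assume c: "c \<in> children G" and d: "d \<in> children G" and "c \<noteq> d" and e: "e \<in> ?E c \<inter> ?E d"
      show False
      proof (cases "root G \<in> e")
        case True
        with e root_notin_branch[of G] have "e = {root G, c}" "e = {root G, d}" by auto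
        with \<open>c \<noteq> d\<close> show False by (auto simp: doubleton_eq_iff)
      next
        case False
        with e have "e \<in> edges G" "e \<subseteq> branch_verts G c" "e \<subseteq> branch_verts G d" by auto
        moreover from this obtain x where "x \<in> e"
          using rooted_treeD(4)[OF G, of e] by fastforce
        ultimately show False using branch_verts_disjoint[OF G c d] \<open>c \<noteq> d\<close> by blast
      qed
    qed
  qed
  also have "\<dots> = (\<Sum>c\<in>children G. num_edges (branch G c) + 1)"
  proof (rule sum.cong[OF refl])
    fix c
    have "{root G, c} \<notin> edges (branch G c)" using root_notin_branch[of G c] by auto
    then show "card (?E c) = num_edges (branch G c) + 1"
      using fin by (simp add: num_edges_def)
  qed
  finally show ?thesis by (simp add: num_edges_def)
qed

lemma card_verts: "rooted_tree G \<Longrightarrow> card (verts G) = num_edges G + 1"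
proof (induction rule: rooted_tree_induct)
  case (branches G)
  then show ?case
    using sum_verts_branches[OF branches.hyps, of "\<lambda>_. 1"] num_edges_branches[OF branches.hyps]
    by simp
qed

lemma sum_level_branch:
  assumes G: "rooted_tree G" and c: "c \<in> children G"
  shows "(\<Sum>v\<in>branch_verts G c. level G v)
       = path_length (branch G c) + num_edges (branch G c) + 1"
proof -
  have "(\<Sum>v\<in>branch_verts G c. level G v) = (\<Sum>v\<in>branch_verts G c. level (branch G c) v + 1)"
    by (rule sum.cong[OF refl]) (rule level_branch[OF G c])
  also have "\<dots> = path_length (branch G c) + card (branch_verts G c)"
    by (simp add: path_length_def sum.distrib del: One_nat_def add_Suc_right)
  also have "card (branch_verts G c) = num_edges (branch G c) + 1"
    using card_verts[OF rooted_tree_branch[OF G c]] by simp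
  finally show ?thesis by simp
qed

lemma path_length_branches:
  assumes "rooted_tree G"
  shows "path_length G
       = (\<Sum>c\<in>children G. path_length (branch G c) + num_edges (branch G c) + 1)"
proof -
  have "path_length G = (\<Sum>c\<in>children G. \<Sum>v\<in>branch_verts G c. level G v)"
    using sum_verts_branches[OF assms, of "level G"] by (simp add: path_length_def)
  also have "\<dots> = (\<Sum>c\<in>children G. path_length (branch G c) + num_edges (branch G c) + 1)"
    by (rule sum.cong[OF refl]) (rule sum_level_branch[OF assms])
  finally show ?thesis .
qed

text \<open>
  Write \<open>a c\<close> for the sum of the levels, in the whole tree, of the vertices of the branch at \<open>c\<close>,
  and \<open>e c\<close> for their number. Distances between the branches at \<open>c \<noteq> d\<close> add up to
  \<open>a c * e d + a d * e c\<close>. Adding the product also for \<open>c = d\<close> completes the double sum over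
  pairs of children to \<open>2 * PL * E\<close>, so that \<open>W - PL * E\<close> becomes a plain sum over the children.
\<close>

lemma wiener_branches:
  assumes G: "rooted_tree G"
  shows "wiener G
      + (\<Sum>c\<in>children G. (path_length (branch G c) + num_edges (branch G c) + 1)
                        * (num_edges (branch G c) + 1))
     = (\<Sum>c\<in>children G. wiener (branch G c) + path_length (branch G c) + num_edges (branch G c) + 1)
      + path_length G * num_edges G"
proof -
  let ?C = "children G"
  let ?B = "branch_verts G"
  define a where "a c = path_length (branch G c) + num_edges (branch G c) + 1" for c
  define e where "e c = num_edges (branch G c) + 1" for c
  define w where "w c = wiener (branch G c)" for c
  define X where "X c d = (\<Sum>u\<in>?B c. \<Sum>v\<in>?B d. gdist G u v)" for c d
  have fin: "finite ?C" by (rule finite_children[OF G])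
  have a_sum: "(\<Sum>v\<in>?B c. level G v) = a c" if "c \<in> ?C" for c
    using sum_level_branch[OF G that] by (simp add: a_def)
  have e_card: "card (?B c) = e c" if "c \<in> ?C" for c
    using card_verts[OF rooted_tree_branch[OF G that]] by (simp add: e_def)
  have PL: "path_length G = sum a ?C" using path_length_branches[OF G] by (simp add: a_def)
  have E: "num_edges G = sum e ?C" using num_edges_branches[OF G] by (simp add: e_def)
  have X: "X c d + (if c = d then 2 * (a c * e c) else 0)
         = (if c = d then 2 * w c else 0) + (a c * e d + e c * a d)"
    if c: "c \<in> ?C" and d: "d \<in> ?C" for c d
  proof (cases "c = d")
    case True
    have "2 * w c = (\<Sum>u\<in>?B c. \<Sum>v\<in>?B c. gdist (branch G c) u v)"
      using double_wiener[of "branch G c"] finite_branch_verts[OF G] by (simp add: w_def)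
    also have "\<dots> = X c c"
      unfolding X_def by (intro sum.cong refl) (simp add: gdist_branch[OF G c])
    finally show ?thesis using True by simp
  next
    case False
    have "X c d = (\<Sum>u\<in>?B c. \<Sum>v\<in>?B d. level G u + level G v)"
      unfolding X_def by (intro sum.cong refl) (simp add: gdist_across_branches[OF G c d False])
    also have "\<dots> = (\<Sum>u\<in>?B c. level G u * e d + a d)"
      by (simp only: sum.distrib sum_constant a_sum[OF d] e_card[OF d] of_nat_id mult.commute)
    also have "\<dots> = a c * e d + e c * a d"
      by (simp only: sum.distrib sum_distrib_right[symmetric] sum_constant a_sum[OF c]
            e_card[OF c] of_nat_id)
    finally show ?thesis using False by simp
  qed
  have "(\<Sum>c\<in>?C. \<Sum>d\<in>?C. X c d + (if c = d then 2 * (a c * e c) else 0))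
      = (\<Sum>c\<in>?C. \<Sum>d\<in>?C. (if c = d then 2 * w c else 0) + (a c * e d + e c * a d))"
    by (intro sum.cong refl X)
  also have "\<dots> = 2 * sum w ?C + (sum a ?C * sum e ?C + sum e ?C * sum a ?C)"
    using fin by (simp add: sum.distrib sum_product flip: sum_distrib_left)
  finally have cross: "(\<Sum>c\<in>?C. \<Sum>d\<in>?C. X c d) + 2 * (\<Sum>c\<in>?C. a c * e c)
      = 2 * sum w ?C + 2 * (sum a ?C * sum e ?C)"
    using fin by (simp add: sum.distrib flip: sum_distrib_left)
  have "2 * wiener G = (\<Sum>u\<in>verts G. \<Sum>v\<in>verts G. gdist G u v)"
    using double_wiener rooted_treeD(1)[OF G] .
  also have "\<dots> = (\<Sum>v\<in>verts G. gdist G (root G) v)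
      + (\<Sum>c\<in>?C. \<Sum>u\<in>?B c. \<Sum>v\<in>verts G. gdist G u v)"
    by (rule sum_verts_branches[OF G])
  also have "(\<Sum>v\<in>verts G. gdist G (root G) v) = sum a ?C"
    using PL by (simp add: path_length_def level_def)
  also have "(\<Sum>c\<in>?C. \<Sum>u\<in>?B c. \<Sum>v\<in>verts G. gdist G u v)
      = (\<Sum>c\<in>?C. \<Sum>u\<in>?B c. level G u + (\<Sum>d\<in>?C. \<Sum>v\<in>?B d. gdist G u v))"
    by (simp add: sum_verts_branches[OF G] level_def gdist_commute[of G _ "root G"])
  also have "\<dots> = sum a ?C + (\<Sum>c\<in>?C. \<Sum>d\<in>?C. X c d)"
    unfolding X_def by (simp add: sum.distrib a_sum) (intro sum.cong refl sum.swap)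
  finally have "wiener G + (\<Sum>c\<in>?C. a c * e c)
      = sum w ?C + sum a ?C + sum a ?C * sum e ?C"
    using cross by simp
  moreover have "sum w ?C + sum a ?C = (\<Sum>c\<in>?C. wiener (branch G c)
      + path_length (branch G c) + num_edges (branch G c) + 1)"
    by (simp only: w_def a_def add.assoc flip: sum.distrib)
  ultimately show ?thesis by (simp only: PL E a_def e_def)
qed

section \<open>Matula numbers and prime factorizations\<close>

lemma nth_prime_prime: "prime (nth_prime m)"
  using enumerate_in_set[OF primes_infinite] by (simp add: nth_prime_def)

lemma less_nth_prime: "m < nth_prime m"
proof -
  have "k + 1 < enumerate {p::nat. prime p} k" for k
  proof (induction k)
    case 0
    show ?case using nth_prime_prime[of 0] prime_gt_1_nat by (simp add: nth_prime_def)
  next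
    case (Suc k)
    with enumerate_step[OF primes_infinite, of k] show ?case by simp
  qed
  from this[of "m - 1"] show ?thesis by (simp add: nth_prime_def)
qed

lemma nth_prime_inj: "inj_on nth_prime {1..}"
proof (rule inj_onI)
  fix a b :: nat
  assume "a \<in> {1..}" "b \<in> {1..}" "nth_prime a = nth_prime b"
  moreover have "inj (enumerate {p::nat. prime p})"
    by (rule inj_enumerate[OF primes_infinite])
  ultimately have "a - 1 = b - 1" by (auto simp: nth_prime_def dest: injD)
  with \<open>a \<in> {1..}\<close> \<open>b \<in> {1..}\<close> show "a = b" by auto
qed

lemma nth_prime_surj:
  assumes "prime p"
  obtains t where "t \<ge> 1" "nth_prime t = p"
proof -
  obtain k where "enumerate {p::nat. prime p} k = p"
    using enumerate_Ex[of "{p::nat. prime p}" p] primes_infinite assms by auto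
  then show ?thesis using that[of "k + 1"] by (simp add: nth_prime_def)
qed

definition prime_index :: "nat \<Rightarrow> nat" where
  "prime_index = inv_into {1..} nth_prime"

lemma prime_index_nth_prime: "t \<ge> 1 \<Longrightarrow> prime_index (nth_prime t) = t"
  using nth_prime_inj by (simp add: prime_index_def)

text \<open>
  By unique factorization, a Matula number determines the multiset of the Matula numbers of the
  branches at the root, which \<open>matulas_of_branches\<close> below proves to be this one.
\<close>

definition child_matulas :: "nat \<Rightarrow> nat multiset" where
  "child_matulas n = image_mset prime_index (prime_factorization n)"

lemma child_matulas_1: "child_matulas 1 = {#}"
  by (simp add: child_matulas_def)

lemma child_matulas_nth_prime: "t \<ge> 1 \<Longrightarrow> child_matulas (nth_prime t) = {#t#}"
  using nth_prime_prime[of t]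
  by (simp add: child_matulas_def prime_factorization_prime prime_index_nth_prime)

lemma child_matulas_mult:
  "r \<ge> 1 \<Longrightarrow> s \<ge> 1 \<Longrightarrow> child_matulas (r * s) = child_matulas r + child_matulas s"
  by (simp add: child_matulas_def prime_factorization_mult)

lemma child_matulas_less:
  assumes "m \<in># child_matulas n"
  shows "1 \<le> m" "m < n"
proof -
  obtain p where p: "p \<in> prime_factors n" "m = prime_index p"
    using assms by (auto simp: child_matulas_def)
  then obtain t where t: "t \<ge> 1" "nth_prime t = p"
    by (meson in_prime_factors_imp_prime nth_prime_surj)
  then have m: "m = t" using p(2) prime_index_nth_prime[OF t(1)] by simp
  with t show "1 \<le> m" by simp
  have "p \<le> n" using p
    by (metis dvd_imp_le in_prime_factors_iff not_gr0)
  with less_nth_prime[of t] t m show "m < n" by simp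
qed

lemma matula_ge_1: "rooted_tree G \<Longrightarrow> matula G \<ge> 1"
  by (subst matula.simps) (simp add: Suc_le_eq prod_pos prime_gt_0_nat nth_prime_prime)

lemma matulas_of_branches:
  assumes G: "rooted_tree G"
  shows "child_matulas (matula G) = image_mset (\<lambda>c. matula (branch G c)) (mset_set (children G))"
proof -
  let ?M = "image_mset (\<lambda>c. nth_prime (matula (branch G c))) (mset_set (children G))"
  have "matula G = prod_mset ?M"
    using G by (subst matula.simps) (simp add: prod_unfold_prod_mset)
  then have "prime_factorization (matula G) = ?M"
    by (simp, intro prime_factorization_prod_mset_primes) (auto simp: nth_prime_prime)
  then have "child_matulas (matula G)
      = image_mset (\<lambda>c. prime_index (nth_prime (matula (branch G c)))) (mset_set (children G))"
    by (simp add: child_matulas_def multiset.map_comp o_def)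
  also have "\<dots> = image_mset (\<lambda>c. matula (branch G c)) (mset_set (children G))"
    using finite_children[OF G] rooted_tree_branch[OF G]
    by (intro image_mset_cong) (auto intro!: prime_index_nth_prime matula_ge_1)
  finally show ?thesis .
qed

lemma sum_branches_matula:
  assumes "rooted_tree G"
  shows "(\<Sum>c\<in>children G. f (matula (branch G c))) = (\<Sum>m\<in>#child_matulas (matula G). f m)"
  by (simp add: matulas_of_branches[OF assms] sum_unfold_sum_mset multiset.map_comp o_def)

lemma matula_branch_less:
  assumes "rooted_tree G" and "c \<in> children G"
  shows "matula (branch G c) < matula G"
proof (rule child_matulas_less(2))
  show "matula (branch G c) \<in># child_matulas (matula G)"
    using assms finite_children by (simp add: matulas_of_branches)
qed

section \<open>Every positive integer is a Matula number\<close>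

definition graft :: "rgraph \<Rightarrow> rgraph \<Rightarrow> rgraph" where
  "graft S T = \<lparr>verts = verts S \<union> verts T,
                edges = insert {root S, root T} (edges S \<union> edges T), root = root S\<rparr>"

lemma graft_simps [simp]:
  "verts (graft S T) = verts S \<union> verts T" "root (graft S T) = root S"
  "edges (graft S T) = insert {root S, root T} (edges S \<union> edges T)"
  by (simp_all add: graft_def)

lemma adj_graft: "adj (graft S T) = adj S \<union> adj T \<union> {(root S, root T), (root T, root S)}"
  by (auto simp: adj_def doubleton_eq_iff)

lemma is_cycle_mono:
  assumes "is_cycle G vs"
    and "\<And>x y. x \<in> set vs \<Longrightarrow> y \<in> set vs \<Longrightarrow> (x, y) \<in> adj G \<Longrightarrow> (x, y) \<in> adj H"
  shows "is_cycle H vs"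
proof -
  have "vs \<noteq> []" using assms(1) by (auto simp: is_cycle_def)
  then show ?thesis using assms by (auto simp: is_cycle_def successively_conv_nth)
qed

lemma cycle_periodic_walk:
  assumes "is_cycle G vs"
  obtains w :: "nat \<Rightarrow> nat" where "\<And>i. (w i, w (Suc i)) \<in> adj G" "range w = set vs"
    "\<And>i j. w i = w j \<longleftrightarrow> i mod length vs = j mod length vs"
proof -
  let ?n = "length vs"
  define w where "w i = vs ! (i mod ?n)" for i
  have n: "3 \<le> ?n" "vs \<noteq> []" using assms by (auto simp: is_cycle_def)
  have "(w i, w (Suc i)) \<in> adj G" for i
  proof (cases "Suc (i mod ?n) = ?n")
    case True
    then have "i mod ?n = ?n - 1" by simp
    then have "w i = last vs" using n by (simp add: w_def last_conv_nth)
    moreover have "w (Suc i) = hd vs" using True n by (simp add: w_def mod_Suc hd_conv_nth)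
    ultimately show ?thesis using assms by (simp add: is_cycle_def)
  next
    case False
    then have "Suc (i mod ?n) < ?n" using n by (simp add: Suc_lessI)
    with False show ?thesis
      using assms by (auto simp: w_def mod_Suc is_cycle_def successively_conv_nth)
  qed
  moreover have "range w = set vs"
  proof (intro equalityI subsetI)
    fix x assume "x \<in> set vs"
    then obtain i where "i < ?n" "vs ! i = x" by (meson in_set_conv_nth)
    then show "x \<in> range w" by (intro image_eqI[of _ _ i]) (simp_all add: w_def)
  qed (use n in \<open>auto simp: w_def\<close>)
  moreover have "w i = w j \<longleftrightarrow> i mod ?n = j mod ?n" for i j
    using assms n by (simp add: w_def is_cycle_def nth_eq_iff_index_eq)
  ultimately show ?thesis by (rule that)
qed

lemma periodic_leaves:
  fixes w :: "nat \<Rightarrow> 'a"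
  assumes "\<And>i j. i mod n = j mod n \<Longrightarrow> w i = w j" and "n > 0"
    and "w a \<in> A" and "w b \<notin> A"
  obtains i where "w i \<in> A" "w (Suc i) \<notin> A"
proof -
  have "\<exists>i. w i \<in> A \<and> w (Suc i) \<notin> A"
  proof (rule ccontr)
    assume no: "\<not> ?thesis"
    have "w (a + k) \<in> A" for k
      by (induction k) (use assms(3) no in auto)
    \<comment> \<open>The index \<open>b + a * n\<close> is congruent to \<open>b\<close> and not less than \<open>a\<close>.\<close>
    from this[of "b + a * n - a"] have "w (b + a * n) \<in> A"
      using \<open>n > 0\<close> by (simp add: trans_le_add2)
    then show False using assms(1)[of "b + a * n" b] assms(4) by simp
  qed
  with that show ?thesis by blast
qed

text \<open>
  A cycle meeting both trees would have to cross from \<open>S\<close> to \<open>T\<close> and back along the only joining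
  edge, hence visit \<open>root S\<close>, \<open>root T\<close>, \<open>root S\<close> in succession, and so have length at most 2.
\<close>

lemma graft_acyclic:
  assumes S: "rooted_tree S" and T: "rooted_tree T" and disj: "verts S \<inter> verts T = {}"
  shows "\<not> is_cycle (graft S T) vs"
proof
  assume cyc: "is_cycle (graft S T) vs"
  let ?n = "length vs"
  have n: "?n \<ge> 3" using cyc by (simp add: is_cycle_def)
  obtain w where w: "\<And>i. (w i, w (Suc i)) \<in> adj (graft S T)" "range w = set vs"
    "\<And>i j. w i = w j \<longleftrightarrow> i mod ?n = j mod ?n"
    by (rule cycle_periodic_walk[OF cyc], rule that)
  have within: "(x, y) \<in> adj S"
    if "(x, y) \<in> adj (graft S T)" "x \<in> verts S" "y \<in> verts S" for x y
    using that disj rooted_treeD(2)[OF T] tree_adjD(1)[OF T] by (auto simp: adj_graft)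
  have within': "(x, y) \<in> adj T"
    if "(x, y) \<in> adj (graft S T)" "x \<in> verts T" "y \<in> verts T" for x y
    using that disj rooted_treeD(2)[OF S] tree_adjD(1)[OF S] by (auto simp: adj_graft)
  have sub: "w i \<in> verts S \<union> verts T" for i
    using w(1)[of i] tree_adjD(1)[OF S] tree_adjD(1)[OF T] rooted_treeD(2)[OF S]
      rooted_treeD(2)[OF T] by (auto simp: adj_graft)
  consider "\<forall>i. w i \<in> verts S" | "\<forall>i. w i \<in> verts T"
    | a b where "w a \<in> verts S" "w b \<in> verts T"
    using sub by blast
  then show False
  proof cases
    case 1
    then have "set vs \<subseteq> verts S" by (auto simp flip: w(2))
    then have "is_cycle S vs" by (intro is_cycle_mono[OF cyc] within) auto
    then show False using rooted_treeD(6)[OF S] by blast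
  next
    case 2
    then have "set vs \<subseteq> verts T" by (auto simp flip: w(2))
    then have "is_cycle T vs" by (intro is_cycle_mono[OF cyc] within') auto
    then show False using rooted_treeD(6)[OF T] by blast
  next
    case 3
    have per: "\<And>i j. i mod ?n = j mod ?n \<Longrightarrow> w i = w j" using w(3) by blast
    have "?n > 0" using n by linarith
    obtain i where i: "w i \<in> verts S" "w (Suc i) \<notin> verts S"
      by (rule periodic_leaves[of ?n w a "verts S" b, OF per \<open>?n > 0\<close>]) (use 3 disj in auto)
    obtain j where j: "w j \<in> verts T" "w (Suc j) \<notin> verts T"
      by (rule periodic_leaves[of ?n w b "verts T" a, OF per \<open>?n > 0\<close>]) (use 3 disj in auto)
    have "w i = root S" "w (Suc i) = root T"
      using i w(1)[of i] disj tree_adjD[OF S] tree_adjD[OF T] rooted_treeD(2)[OF S]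
        rooted_treeD(2)[OF T] by (auto simp: adj_graft)
    moreover have "w j = root T" "w (Suc j) = root S"
      using j w(1)[of j] disj tree_adjD[OF S] tree_adjD[OF T] rooted_treeD(2)[OF S]
        rooted_treeD(2)[OF T] by (auto simp: adj_graft)
    ultimately have "j mod ?n = Suc i mod ?n" "Suc j mod ?n = i mod ?n"
      by (simp_all flip: w(3))
    then have "(i + 2) mod ?n = i mod ?n"
      by (metis add_2_eq_Suc' mod_Suc_eq)
    then have "?n dvd 2"
      by (metis add_diff_cancel_left' le_add1 mod_eq_dvd_iff_nat)
    with n show False by (auto dest: dvd_imp_le)
  qed
qed

lemma rooted_tree_graft:
  assumes S: "rooted_tree S" and T: "rooted_tree T" and disj: "verts S \<inter> verts T = {}"
  shows "rooted_tree (graft S T)"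
  unfolding rooted_tree_def
proof (intro conjI)
  let ?G = "graft S T"
  note rS = rooted_treeD[OF S] and rT = rooted_treeD[OF T]
  show "finite (verts ?G)" "root ?G \<in> verts ?G" using rS rT by auto
  have "root S \<noteq> root T" using rS(2) rT(2) disj by auto
  then show "\<forall>e\<in>edges ?G. e \<subseteq> verts ?G \<and> card e = 2" using rS(2-4) rT(2-4) by auto
  have "(root S, v) \<in> (adj ?G)\<^sup>*" if "v \<in> verts ?G" for v
  proof (cases "v \<in> verts S")
    case True
    then have "(root S, v) \<in> (adj S)\<^sup>*" using rS by blast
    then show ?thesis by (rule rev_subsetD) (rule rtrancl_mono, auto simp: adj_graft)
  next
    case False
    then have "(root T, v) \<in> (adj T)\<^sup>*" using rT that by auto
    then have "(root T, v) \<in> (adj ?G)\<^sup>*"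
      by (rule rev_subsetD) (rule rtrancl_mono, auto simp: adj_graft)
    moreover have "(root S, root T) \<in> adj ?G" by (simp add: adj_graft)
    ultimately show ?thesis by (meson converse_rtrancl_into_rtrancl)
  qed
  then show "\<forall>u\<in>verts ?G. \<forall>v\<in>verts ?G. (u, v) \<in> (adj ?G)\<^sup>*"
    by (meson rtrancl_trans sym_adj sym_rtrancl symD)
  show "\<nexists>vs. is_cycle ?G vs" using graft_acyclic[OF assms] by blast
qed

lemma children_graft:
  assumes "rooted_tree S" and "rooted_tree T" and "verts S \<inter> verts T = {}"
  shows "children (graft S T) = insert (root T) (children S)" "root T \<notin> children S"
proof -
  have "root S \<notin> verts T" "root T \<notin> verts S"
    using assms(3) rooted_treeD(2)[OF assms(1)] rooted_treeD(2)[OF assms(2)] by auto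
  then show "children (graft S T) = insert (root T) (children S)" "root T \<notin> children S"
    using tree_adjD[OF assms(1)] tree_adjD[OF assms(2)] rooted_treeD(2)[OF assms(1)]
    by (auto simp: children_def adj_graft)
qed

text \<open>
  The branches of a grafted tree are identified with this criterion, because reachability inside
  \<open>S\<close> or \<open>T\<close> is known, whereas \<^const>\<open>branch_verts\<close> refers to reachability in the whole tree
  without its root.
\<close>

lemma branch_verts_eqI:
  assumes "B \<subseteq> verts G - {root G}" and "c \<in> B"
    and conn: "\<And>v. v \<in> B \<Longrightarrow> (c, v) \<in> (adj G \<inter> B \<times> B)\<^sup>*"
    and closed: "\<And>x y. x \<in> B \<Longrightarrow> (x, y) \<in> adj G \<Longrightarrow> y \<noteq> root G \<Longrightarrow> y \<in> B"
  shows "branch_verts G c = B"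
proof (intro equalityI subsetI)
  fix v assume "v \<in> branch_verts G c"
  then have "(c, v) \<in> (adj G \<inter> (verts G - {root G}) \<times> (verts G - {root G}))\<^sup>*"
    by (simp add: branch_verts_def)
  then show "v \<in> B" by induction (use assms(2) closed in auto)
next
  fix v assume v: "v \<in> B"
  have "(adj G \<inter> B \<times> B)\<^sup>* \<subseteq> (adj G \<inter> (verts G - {root G}) \<times> (verts G - {root G}))\<^sup>*"
    using assms(1) by (intro rtrancl_mono) auto
  with conn[OF v] v assms(1) show "v \<in> branch_verts G c" by (auto simp: branch_verts_def)
qed

lemma branch_graft_old:
  assumes S: "rooted_tree S" and T: "rooted_tree T" and disj: "verts S \<inter> verts T = {}"
    and c: "c \<in> children S"
  shows "branch (graft S T) c = branch S c"
proof -
  let ?G = "graft S T"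
  let ?B = "branch_verts S c"
  have B: "?B \<subseteq> verts S - {root S}" by (rule branch_verts_subset)
  have "branch_verts ?G c = ?B"
  proof (rule branch_verts_eqI)
    show "?B \<subseteq> verts ?G - {root ?G}" using B by auto
    show "c \<in> ?B" by (rule childD(4)[OF S c])
    fix v assume "v \<in> ?B"
    then have "(c, v) \<in> (adj S \<inter> ?B \<times> ?B)\<^sup>*" using branch_reach[OF S c] by (simp add: adj_branch)
    then show "(c, v) \<in> (adj ?G \<inter> ?B \<times> ?B)\<^sup>*"
      by (rule rev_subsetD) (rule rtrancl_mono, auto simp: adj_graft)
  next
    fix x y assume xy: "x \<in> ?B" "(x, y) \<in> adj ?G" "y \<noteq> root ?G"
    then have "(x, y) \<in> adj S"
      using B disj tree_adjD(1)[OF T] rooted_treeD(2)[OF T] by (auto simp: adj_graft)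
    then show "y \<in> ?B" using branch_verts_closed[OF S] xy by simp
  qed
  moreover have "e \<in> edges S" if e: "e \<in> edges ?G" "e \<subseteq> ?B" for e
  proof -
    have "e \<noteq> {root S, root T}" using e(2) B by auto
    moreover have "e \<notin> edges T"
    proof
      assume eT: "e \<in> edges T"
      then have "e \<subseteq> verts T \<inter> verts S" using rooted_treeD(3)[OF T] e(2) B by blast
      then have "e = {}" using disj by auto
      with rooted_treeD(4)[OF T eT] show False by simp
    qed
    ultimately show ?thesis using e(1) by simp
  qed
  ultimately show ?thesis by (auto simp: branch_def)
qed

lemma branch_graft_new:
  assumes S: "rooted_tree S" and T: "rooted_tree T" and disj: "verts S \<inter> verts T = {}"
  shows "branch (graft S T) (root T) = T"
proof -
  let ?G = "graft S T"
  let ?V = "verts T"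
  have rS: "root S \<notin> ?V" using rooted_treeD(2)[OF S] disj by auto
  have "branch_verts ?G (root T) = ?V"
  proof (rule branch_verts_eqI)
    show "?V \<subseteq> verts ?G - {root ?G}" using rS by auto
    show "root T \<in> ?V" by (rule rooted_treeD(2)[OF T])
    fix v assume "v \<in> ?V"
    then have "(root T, v) \<in> (adj T)\<^sup>*" using rooted_treeD(2,5)[OF T] by blast
    then show "(root T, v) \<in> (adj ?G \<inter> ?V \<times> ?V)\<^sup>*"
      by (rule rev_subsetD) (rule rtrancl_mono, use tree_adjD[OF T] in \<open>auto simp: adj_graft\<close>)
  next
    fix x y assume "x \<in> ?V" "(x, y) \<in> adj ?G" "y \<noteq> root ?G"
    then show "y \<in> ?V"
      using disj rS tree_adjD[OF S] tree_adjD[OF T] by (auto simp: adj_graft)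
  qed
  moreover have "{e \<in> edges ?G. e \<subseteq> ?V} = edges T"
  proof -
    have "e = {}" if "e \<in> edges S" "e \<subseteq> ?V" for e
      using rooted_treeD(3)[OF S that(1)] that(2) disj by auto
    then show ?thesis
      using rS rooted_treeD(3)[OF T] rooted_treeD(4)[OF S] by fastforce
  qed
  ultimately show ?thesis by (simp add: branch_def)
qed

lemma matula_graft:
  assumes S: "rooted_tree S" and T: "rooted_tree T" and disj: "verts S \<inter> verts T = {}"
  shows "matula (graft S T) = matula S * nth_prime (matula T)"
proof -
  let ?f = "\<lambda>G c. nth_prime (matula (branch G c))"
  have "matula (graft S T) = (\<Prod>c\<in>children (graft S T). ?f (graft S T) c)"
    using rooted_tree_graft[OF assms] by (subst matula.simps) simp
  also have "\<dots> = ?f (graft S T) (root T) * (\<Prod>c\<in>children S. ?f (graft S T) c)"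
    using children_graft[OF assms] finite_children[OF S] by simp
  also have "(\<Prod>c\<in>children S. ?f (graft S T) c) = (\<Prod>c\<in>children S. ?f S c)"
    by (intro prod.cong refl) (simp add: branch_graft_old[OF assms])
  also have "\<dots> = matula S"
    using S by (subst (2) matula.simps) simp
  finally show ?thesis by (simp add: branch_graft_new[OF assms])
qed

lemma single_vertex_tree:
  assumes "verts G = {v}" and "edges G = {}" and "root G = v"
  shows "rooted_tree G" "matula G = 1"
proof -
  have adj: "adj G = {}" using assms by (simp add: adj_def)
  then show G: "rooted_tree G" using assms by (auto simp: rooted_tree_def is_cycle_def)
  show "matula G = 1" using G adj by (subst matula.simps) (simp add: children_def)
qed

text \<open>
  Grafting needs disjoint vertex sets. Producing trees whose vertices lie above any prescribed
  bound \<open>k\<close> makes this possible without relabelling vertices.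
\<close>

lemma matula_surj_above:
  "n \<ge> 1 \<Longrightarrow> \<exists>G. rooted_tree G \<and> matula G = n \<and> verts G \<subseteq> {k..}"
proof (induction n arbitrary: k rule: less_induct)
  case (less n)
  show ?case
  proof (cases "n = 1")
    case True
    let ?G = "\<lparr>verts = {k}, edges = {}, root = k\<rparr>"
    show ?thesis
      using True single_vertex_tree[of ?G k] by (intro exI[of _ ?G]) simp
  next
    case False
    then obtain p where p: "prime p" "p dvd n" by (meson prime_factor_nat)
    then obtain t where t: "t \<ge> 1" "nth_prime t = p" by (meson nth_prime_surj)
    obtain r where r: "n = r * p" using p(2) by (metis dvdE mult.commute)
    have "r \<ge> 1" using r less.prems by (cases r) auto
    have "r < n" using r \<open>r \<ge> 1\<close> prime_gt_1_nat[OF p(1)] by simp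
    have "t < n" using less_nth_prime[of t] t(2) dvd_imp_le[OF p(2)] less.prems by simp
    from less.IH[OF \<open>r < n\<close> \<open>r \<ge> 1\<close>] obtain S
      where S: "rooted_tree S" "matula S = r" "verts S \<subseteq> {k..}" by blast
    define l where "l = max k (Suc (Max (verts S)))"
    from less.IH[OF \<open>t < n\<close> \<open>t \<ge> 1\<close>] obtain T
      where T: "rooted_tree T" "matula T = t" "verts T \<subseteq> {l..}" by blast
    have "v < l" if "v \<in> verts S" for v
      using Max_ge[OF rooted_treeD(1)[OF S(1)] that] by (simp add: l_def)
    then have disj: "verts S \<inter> verts T = {}" using T(3) by fastforce
    have "verts (graft S T) \<subseteq> {k..}" using S(3) T(3) by (auto simp: l_def)
    then show ?thesis
      using rooted_tree_graft[OF S(1) T(1) disj] matula_graft[OF S(1) T(1) disj] S(2) T(2) t r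
      by blast
  qed
qed

lemma tau:
  assumes "n \<ge> 1"
  shows "rooted_tree (tau n)" "matula (tau n) = n"
proof -
  have "\<exists>G. rooted_tree G \<and> matula G = n" using matula_surj_above[OF assms] by blast
  from someI_ex[OF this] show "rooted_tree (tau n)" "matula (tau n) = n"
    by (simp_all add: tau_def)
qed

section \<open>The statistics as functions of the Matula number\<close>

lemma statistics_child_matulas:
  assumes G: "rooted_tree G"
    and edges: "\<And>c. c \<in> children G \<Longrightarrow> num_edges (branch G c) = e (matula (branch G c))"
    and path: "\<And>c. c \<in> children G \<Longrightarrow> path_length (branch G c) = p (matula (branch G c))"
    and wiener: "\<And>c. c \<in> children G \<Longrightarrow> wiener (branch G c) = w (matula (branch G c))"
  shows "num_edges G = (\<Sum>m\<in>#child_matulas (matula G). e m + 1)"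
    and "path_length G = (\<Sum>m\<in>#child_matulas (matula G). p m + e m + 1)"
    and "wiener G + (\<Sum>m\<in>#child_matulas (matula G). (p m + e m + 1) * (e m + 1))
       = (\<Sum>m\<in>#child_matulas (matula G). w m + p m + e m + 1) + path_length G * num_edges G"
proof -
  note sums = sum_branches_matula[OF G, symmetric]
  show "num_edges G = (\<Sum>m\<in>#child_matulas (matula G). e m + 1)"
    unfolding sums num_edges_branches[OF G] by (simp add: edges cong: sum.cong)
  show "path_length G = (\<Sum>m\<in>#child_matulas (matula G). p m + e m + 1)"
    unfolding sums path_length_branches[OF G] by (simp add: edges path cong: sum.cong)
  show "wiener G + (\<Sum>m\<in>#child_matulas (matula G). (p m + e m + 1) * (e m + 1))
      = (\<Sum>m\<in>#child_matulas (matula G). w m + p m + e m + 1) + path_length G * num_edges G"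
    unfolding sums using wiener_branches[OF G] by (simp add: edges path wiener cong: sum.cong)
qed

text \<open>
  The three statistics of a tree are determined by those of its branches, and the Matula numbers
  of the branches by that of the tree. So trees with equal Matula numbers have equal statistics,
  by induction and without constructing an isomorphism between them.
\<close>

lemma statistics_matula:
  assumes "rooted_tree G"
  shows "num_edges G = num_edges (tau (matula G)) \<and>
    path_length G = path_length (tau (matula G)) \<and> wiener G = wiener (tau (matula G))"
  using assms
proof (induction "matula G" arbitrary: G rule: less_induct)
  case less
  let ?e = "\<lambda>m. num_edges (tau m)" and ?p = "\<lambda>m. path_length (tau m)"
    and ?w = "\<lambda>m. wiener (tau m)"
  have IH: "num_edges (branch H c) = ?e (matula (branch H c))"
      "path_length (branch H c) = ?p (matula (branch H c))"
      "wiener (branch H c) = ?w (matula (branch H c))"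
    if "rooted_tree H" "matula H = matula G" "c \<in> children H" for H c
    using less.hyps[of "branch H c"] matula_branch_less[OF that(1,3)]
      rooted_tree_branch[OF that(1,3)] that(2)
    by auto
  have T: "rooted_tree (tau (matula G))" "matula (tau (matula G)) = matula G"
    using tau matula_ge_1[OF less.prems] by blast+
  show ?case
    using statistics_child_matulas[of G ?e ?p ?w, OF less.prems IH[OF less.prems refl]]
      statistics_child_matulas[of "tau (matula G)" ?e ?p ?w, OF T(1) IH[OF T], unfolded T(2)]
    by simp
qed

lemma statistics_tau:
  assumes "n \<ge> 1"
  shows num_edges_tau:
      "num_edges (tau n) = (\<Sum>m\<in>#child_matulas n. num_edges (tau m) + 1)"
    and path_length_tau:
      "path_length (tau n)
        = (\<Sum>m\<in>#child_matulas n. path_length (tau m) + num_edges (tau m) + 1)"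
    and wiener_tau:
      "wiener (tau n)
        + (\<Sum>m\<in>#child_matulas n. (path_length (tau m) + num_edges (tau m) + 1)
                                * (num_edges (tau m) + 1))
       = (\<Sum>m\<in>#child_matulas n. wiener (tau m) + path_length (tau m) + num_edges (tau m) + 1)
        + path_length (tau n) * num_edges (tau n)"
proof -
  let ?e = "\<lambda>m. num_edges (tau m)" and ?p = "\<lambda>m. path_length (tau m)"
    and ?w = "\<lambda>m. wiener (tau m)"
  note T = tau[OF assms]
  have "num_edges (branch (tau n) c) = ?e (matula (branch (tau n) c))"
      "path_length (branch (tau n) c) = ?p (matula (branch (tau n) c))"
      "wiener (branch (tau n) c) = ?w (matula (branch (tau n) c))"
    if "c \<in> children (tau n)" for c
    using statistics_matula[OF rooted_tree_branch[OF T(1) that]] by blast+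
  note * = statistics_child_matulas[of "tau n" ?e ?p ?w, OF T(1) this, unfolded T(2)]
  show "num_edges (tau n) = (\<Sum>m\<in>#child_matulas n. num_edges (tau m) + 1)"
    by (rule *(1))
  show "path_length (tau n)
      = (\<Sum>m\<in>#child_matulas n. path_length (tau m) + num_edges (tau m) + 1)"
    by (rule *(2))
  show "wiener (tau n)
        + (\<Sum>m\<in>#child_matulas n. (path_length (tau m) + num_edges (tau m) + 1)
                                * (num_edges (tau m) + 1))
       = (\<Sum>m\<in>#child_matulas n. wiener (tau m) + path_length (tau m) + num_edges (tau m) + 1)
        + path_length (tau n) * num_edges (tau n)"
    by (rule *(3))
qed

theorem proposition3p17:
  fixes n :: nat
  assumes "n \<ge> 1"
  shows "(n = 1 \<longrightarrow> wiener (tau n) = 0) \<and>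
    (\<forall>t \<ge> 1. n = nth_prime t \<longrightarrow>
       wiener (tau n) = wiener (tau t) + path_length (tau t) + num_edges (tau t) + 1) \<and>
    (\<forall>r \<ge> 2. \<forall>s \<ge> 2. n = r * s \<longrightarrow>
       wiener (tau n) = wiener (tau r) + wiener (tau s)
         + path_length (tau r) * num_edges (tau s) + path_length (tau s) * num_edges (tau r))"
proof (intro conjI allI impI)
  assume "n = 1"
  with statistics_tau[OF assms] show "wiener (tau n) = 0" by (simp add: child_matulas_1[simplified])
next
  fix t assume "t \<ge> 1" "n = nth_prime t"
  with statistics_tau[OF assms] show
    "wiener (tau n) = wiener (tau t) + path_length (tau t) + num_edges (tau t) + 1"
    by (simp add: child_matulas_nth_prime)
next
  fix r s :: nat assume rs: "r \<ge> 2" "s \<ge> 2" "n = r * s"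
  then have 1: "r \<ge> 1" "s \<ge> 1" by auto
  have cm: "child_matulas n = child_matulas r + child_matulas s"
    using child_matulas_mult[OF 1] rs(3) by simp
  have "num_edges (tau n) = num_edges (tau r) + num_edges (tau s)"
    using num_edges_tau[OF assms] num_edges_tau[OF 1(1)] num_edges_tau[OF 1(2)]
    by (simp add: cm)
  moreover have "path_length (tau n) = path_length (tau r) + path_length (tau s)"
    using path_length_tau[OF assms] path_length_tau[OF 1(1)] path_length_tau[OF 1(2)]
    by (simp add: cm)
  ultimately show "wiener (tau n) = wiener (tau r) + wiener (tau s)
      + path_length (tau r) * num_edges (tau s) + path_length (tau s) * num_edges (tau r)"
    using wiener_tau[OF assms] wiener_tau[OF 1(1)] wiener_tau[OF 1(2)]
    by (simp add: cm algebra_simps)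
qed

end
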